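(* Let $a_0,a_1,\alpha,\beta,u,v\in\mathbb{R}$ with $\alpha\beta\neq 0$, $uv\neq 0$ and $|a_0|+|a_1|\neq 0$, and let $(a_{n,k})_{0\le k\le n}$ be the binary binomial interpolated triangle with parameters $(a_0,a_1,\alpha,\beta;u,v)$. Let $\bar{s}_n=\sum_{k=0}^{n}(-1)^k a_{n,k}$ be the alternating sum of the entries of row $n$. Then the sequence $(\bar{s}_n)_{n\ge 0}$ satisfies the fourth order linear homogeneous recurrence $$\bar{s}_{n} = (\alpha-\mathcal{A})\bar{s}_{n-1}+(\beta+\alpha \mathcal{A}+\mathcal{B})\bar{s}_{n-2}-(\alpha \mathcal{B}-\beta \mathcal{A})\bar{s}_{n-3}-\beta \mathcal{B}\, \bar{s}_{n-4}\qquad\text{for all } n\ge 4,$$ where $\mathcal{A}=u\alpha+2v$ and $\mathcal{B}=u^2\beta-uv\alpha-v^2$.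
   Context: The binary binomial interpolated triangle with parameters $(a_0,a_1,\alpha,\beta;u,v)$ is the array of real numbers $a_{n,k}$ ($0\le k\le n$) defined as follows. Its left diagonal is $a_{n,0}=a_n$, where $(a_n)_{n\ge0}$ has initial values $a_0,a_1$ and satisfies $a_n=\alpha a_{n-1}+\beta a_{n-2}$ for $n\ge 2$. The other entries are given by $a_{n,k}=u\,a_{n,k-1}+v\,a_{n-1,k-1}$ for $1\le k\le n$. *)

theory Defs
  imports Complex_Main
begin

fun binary_seq :: "real \<Rightarrow> real \<Rightarrow> real \<Rightarrow> real \<Rightarrow> nat \<Rightarrow> real" where
  "binary_seq a\<^sub>0 a\<^sub>1 \<alpha> \<beta> 0 = a\<^sub>0"
| "binary_seq a\<^sub>0 a\<^sub>1 \<alpha> \<beta> (Suc 0) = a\<^sub>1"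
| "binary_seq a\<^sub>0 a\<^sub>1 \<alpha> \<beta> (Suc (Suc n)) =
     \<alpha> * binary_seq a\<^sub>0 a\<^sub>1 \<alpha> \<beta> (Suc n) + \<beta> * binary_seq a\<^sub>0 a\<^sub>1 \<alpha> \<beta> n"

text \<open>
  The triangle consists of the entries with \<open>k \<le> n\<close>. The second equation below only makes
  the function total; the recursion for entries with \<open>k \<le> n\<close> never leaves the triangle.
\<close>

fun binary_binomial_triangle ::
  "real \<Rightarrow> real \<Rightarrow> real \<Rightarrow> real \<Rightarrow> real \<Rightarrow> real \<Rightarrow> nat \<Rightarrow> nat \<Rightarrow> real" where
  "binary_binomial_triangle a\<^sub>0 a\<^sub>1 \<alpha> \<beta> u v n 0 = binary_seq a\<^sub>0 a\<^sub>1 \<alpha> \<beta> n"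
| "binary_binomial_triangle a\<^sub>0 a\<^sub>1 \<alpha> \<beta> u v 0 (Suc k) = 0"
| "binary_binomial_triangle a\<^sub>0 a\<^sub>1 \<alpha> \<beta> u v (Suc n) (Suc k) =
     u * binary_binomial_triangle a\<^sub>0 a\<^sub>1 \<alpha> \<beta> u v (Suc n) k
     + v * binary_binomial_triangle a\<^sub>0 a\<^sub>1 \<alpha> \<beta> u v n k"

definition alternating_row_sum :: "(nat \<Rightarrow> nat \<Rightarrow> real) \<Rightarrow> nat \<Rightarrow> real" where
  "alternating_row_sum a n = (\<Sum>k=0..n. (-1) ^ k * a n k)"

end

theory Submission
  imports Defs
begin

text \<open>
  Every column of the triangle inherits the recurrence of the left diagonal. Hence every descending
  diagonal satisfies the recurrence with coefficients \<open>A\<close> and \<open>B\<close>, since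
  \<open>u x + v\<close> is a root of \<open>z\<^sup>2 - A z - B\<close> whenever \<open>x\<close> is a root of \<open>z\<^sup>2 - \<alpha> z - \<beta>\<close>.
  Summing along the diagonals shows that \<open>s (n + 2) + A s (n + 1) - B s n\<close> is a combination of
  entries of the first two columns, so it satisfies the recurrence of the left diagonal. The
  characteristic polynomial \<open>(z\<^sup>2 - \<alpha> z - \<beta>) (z\<^sup>2 + A z - B)\<close> gives the claim.
\<close>

text \<open>Column \<open>Suc k\<close> is a fixed linear combination of column \<open>k\<close> and
  its shift by one row, so linear recurrences pass on. The bound keeps all three entries inside the
  triangle.\<close>

lemma binary_binomial_triangle_column_recurrence:
  assumes "k \<le> n"
  shows "binary_binomial_triangle a\<^sub>0 a\<^sub>1 \<alpha> \<beta> u v (Suc (Suc n)) k =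
           \<alpha> * binary_binomial_triangle a\<^sub>0 a\<^sub>1 \<alpha> \<beta> u v (Suc n) k
           + \<beta> * binary_binomial_triangle a\<^sub>0 a\<^sub>1 \<alpha> \<beta> u v n k"
  using assms
proof (induction k arbitrary: n)
  case 0
  then show ?case by simp
next
  case (Suc k)
  then obtain m where n: "n = Suc m" and "k \<le> m"
    by (cases n) auto
  then have "k \<le> n" by simp
  show ?case
    using Suc.IH[OF \<open>k \<le> n\<close>] Suc.IH[OF \<open>k \<le> m\<close>] by (simp add: n algebra_simps)
qed

text \<open>Unfolding the triangle rule reduces both sides to column \<open>k\<close> in rows
  \<open>n\<close> to \<open>n + 2\<close>; the column recurrence then eliminates row
  \<open>n + 2\<close>.\<close>

lemma binary_binomial_triangle_diagonal_recurrence: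
  assumes "k \<le> n"
  shows "binary_binomial_triangle a\<^sub>0 a\<^sub>1 \<alpha> \<beta> u v (Suc (Suc n)) (Suc (Suc k)) =
           (u * \<alpha> + 2 * v) * binary_binomial_triangle a\<^sub>0 a\<^sub>1 \<alpha> \<beta> u v (Suc n) (Suc k)
           + (u\<^sup>2 * \<beta> - u * v * \<alpha> - v\<^sup>2) * binary_binomial_triangle a\<^sub>0 a\<^sub>1 \<alpha> \<beta> u v n k"
  using binary_binomial_triangle_column_recurrence[OF assms, of a\<^sub>0 a\<^sub>1 \<alpha> \<beta> u v]
  by (simp add: algebra_simps power2_eq_square)

lemma alternating_row_sum_Suc:
  "alternating_row_sum a (Suc n) = a (Suc n) 0 - (\<Sum>k=0..n. (-1) ^ k * a (Suc n) (Suc k))"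
  by (simp add: alternating_row_sum_def sum.atLeast0_atMost_Suc_shift sum_negf
      del: sum.cl_ivl_Suc)

lemma alternating_row_sum_Suc_Suc:
  assumes "\<And>k. k \<le> n \<Longrightarrow> a (Suc (Suc n)) (Suc (Suc k)) = A * a (Suc n) (Suc k) + B * a n k"
  shows "alternating_row_sum a (Suc (Suc n)) =
           a (Suc (Suc n)) 0 - a (Suc (Suc n)) (Suc 0) + A * a (Suc n) 0
           - A * alternating_row_sum a (Suc n) + B * alternating_row_sum a n"
proof -
  have "alternating_row_sum a (Suc (Suc n)) =
      a (Suc (Suc n)) 0 - a (Suc (Suc n)) (Suc 0)
      + (\<Sum>k=0..n. (-1) ^ k * a (Suc (Suc n)) (Suc (Suc k)))"
    by (simp add: alternating_row_sum_def sum.atLeast0_atMost_Suc_shift del: sum.cl_ivl_Suc)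
  also have "(\<Sum>k=0..n. (-1) ^ k * a (Suc (Suc n)) (Suc (Suc k))) =
      (\<Sum>k=0..n. A * ((-1) ^ k * a (Suc n) (Suc k)) + B * ((-1) ^ k * a n k))"
    by (rule sum.cong) (simp_all add: assms algebra_simps)
  \<comment> \<open>Shifting the column index by one flips the signs, so the first part is row
    \<open>Suc n\<close> without its first entry, negated.\<close>
  also have "\<dots> = A * (a (Suc n) 0 - alternating_row_sum a (Suc n)) + B * alternating_row_sum a n"
    by (simp add: alternating_row_sum_Suc sum.distrib sum_distrib_left)
      (simp add: alternating_row_sum_def sum_distrib_left)
  finally show ?thesis by (simp add: algebra_simps)
qed

theorem theorem7:
  fixes a\<^sub>0 a\<^sub>1 \<alpha> \<beta> u v A B :: real and s :: "nat \<Rightarrow> real"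
  assumes "\<alpha> * \<beta> \<noteq> 0"
    and "u * v \<noteq> 0"
    and "\<bar>a\<^sub>0\<bar> + \<bar>a\<^sub>1\<bar> \<noteq> 0"
  defines "s \<equiv> alternating_row_sum (binary_binomial_triangle a\<^sub>0 a\<^sub>1 \<alpha> \<beta> u v)"
    and "A \<equiv> u * \<alpha> + 2 * v"
    and "B \<equiv> u\<^sup>2 * \<beta> - u * v * \<alpha> - v\<^sup>2"
  shows "\<forall>n\<ge>4. s n = (\<alpha> - A) * s (n - 1) + (\<beta> + \<alpha> * A + B) * s (n - 2)
                     - (\<alpha> * B - \<beta> * A) * s (n - 3) - \<beta> * B * s (n - 4)"
proof (intro allI impI)
  fix n :: nat
  assume "n \<ge> 4"
  define t where "t = binary_binomial_triangle a\<^sub>0 a\<^sub>1 \<alpha> \<beta> u v"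
  define d where
    "d m = t (Suc (Suc m)) 0 - t (Suc (Suc m)) (Suc 0) + A * t (Suc m) 0" for m
  have column: "t (Suc (Suc m)) k = \<alpha> * t (Suc m) k + \<beta> * t m k" if "k \<le> m" for m k
    unfolding t_def using that by (rule binary_binomial_triangle_column_recurrence)
  have d: "d (Suc (Suc m)) = \<alpha> * d (Suc m) + \<beta> * d m" for m
    \<comment> \<open>Column 1 enters \<open>d m\<close> only from row \<open>m + 2\<close> on,
      hence inside the triangle even for \<open>m = 0\<close>.\<close>
    unfolding d_def column[of 0 "Suc (Suc m)", simplified] column[of 0 "Suc m", simplified]
      column[of "Suc 0" "Suc (Suc m)", simplified]
    by (simp add: algebra_simps)
  have s: "s (Suc (Suc m)) = d m - A * s (Suc m) + B * s m" for m
    unfolding s_def d_def t_def A_def B_def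
    by (rule alternating_row_sum_Suc_Suc) (rule binary_binomial_triangle_diagonal_recurrence)
  have d_eq: "d m = s (Suc (Suc m)) + A * s (Suc m) - B * s m" for m
    by (simp add: s)
  obtain m where n: "n = Suc (Suc (Suc (Suc m)))"
    using \<open>n \<ge> 4\<close> that[of "n - 4"] by simp
  show "s n = (\<alpha> - A) * s (n - 1) + (\<beta> + \<alpha> * A + B) * s (n - 2)
              - (\<alpha> * B - \<beta> * A) * s (n - 3) - \<beta> * B * s (n - 4)"
    \<comment> \<open>With \<open>d\<close> expressed through \<open>s\<close>, its recurrence
      relates \<open>s m\<close> to \<open>s (m + 4)\<close>; solve for the latter.\<close>
    using d[of m] unfolding d_eq by (simp add: n numeral_eq_Suc algebra_simps)
qed

end
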